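(* There exist virtual RAAGs $A_\phi=A_\Gamma\rtimes_\phi\langle t\rangle$, where $\phi\in\mathrm{Aut}(A_\Gamma)$ is a finite order non-length-preserving automorphism, such that the language $\mathsf{ConjGeo}(A_\phi,\widehat X)$ is regular.
   Context: For a finite simple graph $\Gamma$, $A_\Gamma$ is the right-angled Artin group (RAAG) generated by $V(\Gamma)$ with relations $st=ts$ whenever $\{s,t\}\in E(\Gamma)$; its standard generating set is $X=V(\Gamma)^{\pm1}$. In $A_\phi=A_\Gamma\rtimes_\phi\langle t\rangle$, $t$ has finite order $m$ with $\phi^m=\mathrm{id}$, and $t^{-1}xt=\phi(x)$ for $x\in X$; its standard generating set is $\widehat X=X\cup\{t^{\pm1}\}$. For a group $G$ with finite inverse-closed generating set $Y$, $|g|$ is the length of a shortest word over $Y$ representing $g$, $\pi:Y^{\ast}\to G$ is the natural projection, and $l(w)$ is word length. An automorphism $\phi$ of $A_\Gamma$ is length-preserving if $|\phi(g)|=|g|$ for all $g$ (lengths over $X$), and non-length-preserving otherwise. $\mathsf{ConjGeo}(G,Y)=\{w\in Y^{\ast}: l(w)=\min\{|h|: h\text{ conjugate to }\pi(w)\text{ in }G\}\}$. *)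

theory Defs
  imports "HOL-Algebra.Algebra" "Graph_Theory.Pair_Digraph"
begin

section \<open>Group presentations\<close>

text \<open>A word over \<open>S\<^sup>\<plusminus>\<^sup>1\<close> is a list over \<open>S \<times> UNIV\<close>: \<open>(s, True)\<close> stands for \<open>s\<close> and
  \<open>(s, False)\<close> for its formal inverse. A relation \<open>u = v\<close> is the pair \<open>(u, v)\<close>.\<close>

type_synonym 'a gword = "('a \<times> bool) list"

inductive_set word_eq :: "'a set \<Rightarrow> ('a gword \<times> 'a gword) set \<Rightarrow> ('a gword \<times> 'a gword) set"
  for S :: "'a set" and R :: "('a gword \<times> 'a gword) set"
where
  refl: "u \<in> lists (S \<times> UNIV) \<Longrightarrow> (u, u) \<in> word_eq S R"
| sym: "(u, v) \<in> word_eq S R \<Longrightarrow> (v, u) \<in> word_eq S R"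
| trans: "(u, v) \<in> word_eq S R \<Longrightarrow> (v, w) \<in> word_eq S R \<Longrightarrow> (u, w) \<in> word_eq S R"
| cancel: "s \<in> S \<Longrightarrow> u \<in> lists (S \<times> UNIV) \<Longrightarrow> v \<in> lists (S \<times> UNIV) \<Longrightarrow>
    (u @ [(s, b), (s, \<not> b)] @ v, u @ v) \<in> word_eq S R"
| rel: "(p, q) \<in> R \<Longrightarrow> p \<in> lists (S \<times> UNIV) \<Longrightarrow> q \<in> lists (S \<times> UNIV) \<Longrightarrow>
    u \<in> lists (S \<times> UNIV) \<Longrightarrow> v \<in> lists (S \<times> UNIV) \<Longrightarrow>
    (u @ p @ v, u @ q @ v) \<in> word_eq S R"

definition word_class :: "'a set \<Rightarrow> ('a gword \<times> 'a gword) set \<Rightarrow> 'a gword \<Rightarrow> 'a gword set" where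
  "word_class S R w = word_eq S R `` {w}"

definition presented_group ::
  "'a set \<Rightarrow> ('a gword \<times> 'a gword) set \<Rightarrow> 'a gword set monoid" where
  "presented_group S R =
    \<lparr>carrier = lists (S \<times> UNIV) // word_eq S R,
     monoid.mult = (\<lambda>P Q. \<Union>u\<in>P. \<Union>v\<in>Q. word_class S R (u @ v)),
     one = word_class S R []\<rparr>"

lemma word_eq_in_lists:
  "(u, v) \<in> word_eq S R \<Longrightarrow> u \<in> lists (S \<times> UNIV) \<and> v \<in> lists (S \<times> UNIV)"
  by (induction rule: word_eq.induct) auto

lemma equiv_word_eq: "equiv (lists (S \<times> UNIV)) (word_eq S R)"
  by (rule equivI)
    (auto intro!: refl_onI symI transI intro: word_eq.intros dest: word_eq_in_lists)

lemma word_eq_context: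
  "(u, v) \<in> word_eq S R \<Longrightarrow> a \<in> lists (S \<times> UNIV) \<Longrightarrow> c \<in> lists (S \<times> UNIV) \<Longrightarrow>
    (a @ u @ c, a @ v @ c) \<in> word_eq S R"
proof (induction rule: word_eq.induct)
  case (refl u)
  then show ?case by (intro word_eq.refl) auto
next
  case (sym u v)
  then show ?case by (blast intro: word_eq.sym)
next
  case (trans u v w)
  then show ?case by (blast intro: word_eq.trans)
next
  case (cancel s u v b)
  then show ?case using word_eq.cancel[of s S "a @ u" "v @ c" b R] by simp
next
  case (rel p q u v)
  then show ?case using word_eq.rel[of p q R S "a @ u" "v @ c"] by simp
qed

lemma word_eq_append:
  assumes "(u, u') \<in> word_eq S R" "(v, v') \<in> word_eq S R"
  shows "(u @ v, u' @ v') \<in> word_eq S R"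
  using word_eq_context[OF assms(1), of "[]" v] word_eq_context[OF assms(2), of u' "[]"]
    word_eq_in_lists[OF assms(1)] word_eq_in_lists[OF assms(2)]
  by (auto intro: word_eq.trans)

lemma presented_group_mult:
  assumes "u \<in> lists (S \<times> UNIV)" "v \<in> lists (S \<times> UNIV)"
  shows "word_class S R u \<otimes>\<^bsub>presented_group S R\<^esub> word_class S R v = word_class S R (u @ v)"
proof -
  have "(\<lambda>u v. word_class S R (u @ v)) respects2 word_eq S R"
    unfolding word_class_def
    by (intro congruent2I') (rule equiv_class_eq[OF equiv_word_eq], erule (1) word_eq_append)
  then show ?thesis
    using UN_equiv_class2[OF equiv_word_eq equiv_word_eq _ assms]
    by (simp add: presented_group_def word_class_def)
qed

lemma word_inverse:
  "u \<in> lists (S \<times> UNIV) \<Longrightarrow> (rev (map (\<lambda>(s, b). (s, \<not> b)) u) @ u, []) \<in> word_eq S R"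
proof (induction u)
  case Nil
  then show ?case by (auto intro: word_eq.refl)
next
  case (Cons x u)
  obtain s b where x: "x = (s, b)" by (cases x)
  let ?i = "rev (map (\<lambda>(s, b). (s, \<not> b)) u)"
  have "?i \<in> lists (S \<times> UNIV)" using Cons.prems by (auto simp: in_lists_conv_set)
  then have "(?i @ [(s, \<not> b), (s, \<not> \<not> b)] @ u, ?i @ u) \<in> word_eq S R"
    using Cons.prems x by (intro word_eq.cancel) auto
  then show ?case using Cons x by (auto intro: word_eq.trans)
qed

lemma carrier_presented_group:
  "carrier (presented_group S R) = word_class S R ` lists (S \<times> UNIV)"
  by (auto simp: presented_group_def word_class_def quotient_def)

lemma group_presented_group: "group (presented_group S R)"
proof (rule groupI)
  have one: "\<one>\<^bsub>presented_group S R\<^esub> = word_class S R []"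
    by (simp add: presented_group_def)
  show "\<one>\<^bsub>presented_group S R\<^esub> \<in> carrier (presented_group S R)"
    by (auto simp: one carrier_presented_group)
  fix x assume "x \<in> carrier (presented_group S R)"
  then obtain u where u: "u \<in> lists (S \<times> UNIV)" "x = word_class S R u"
    by (auto simp: carrier_presented_group)
  show "\<one>\<^bsub>presented_group S R\<^esub> \<otimes>\<^bsub>presented_group S R\<^esub> x = x"
    using u by (simp add: one presented_group_mult)
  let ?i = "rev (map (\<lambda>(s, b). (s, \<not> b)) u)"
  have i: "?i \<in> lists (S \<times> UNIV)" using u by (auto simp: in_lists_conv_set)
  have "word_class S R (?i @ u) = word_class S R []"
    using word_inverse[OF u(1)] unfolding word_class_def
    by (rule equiv_class_eq[OF equiv_word_eq])
  then show "\<exists>y\<in>carrier (presented_group S R).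
      y \<otimes>\<^bsub>presented_group S R\<^esub> x = \<one>\<^bsub>presented_group S R\<^esub>"
    using i u by (auto simp: one carrier_presented_group presented_group_mult)
next
  have app: "u @ v \<in> lists (S \<times> UNIV)" if "u \<in> lists (S \<times> UNIV)" "v \<in> lists (S \<times> UNIV)"
    for u v :: "'a gword" using that by simp
  fix x y z
  assume "x \<in> carrier (presented_group S R)" "y \<in> carrier (presented_group S R)"
  then obtain u v where uv: "u \<in> lists (S \<times> UNIV)" "x = word_class S R u"
    "v \<in> lists (S \<times> UNIV)" "y = word_class S R v"
    unfolding carrier_presented_group by blast
  show "x \<otimes>\<^bsub>presented_group S R\<^esub> y \<in> carrier (presented_group S R)"
    unfolding uv(2,4) presented_group_mult[OF uv(1,3)] carrier_presented_group
    by (intro imageI app uv)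
  assume "z \<in> carrier (presented_group S R)"
  then obtain w where w: "w \<in> lists (S \<times> UNIV)" "z = word_class S R w"
    unfolding carrier_presented_group by blast
  show "x \<otimes>\<^bsub>presented_group S R\<^esub> y \<otimes>\<^bsub>presented_group S R\<^esub> z
      = x \<otimes>\<^bsub>presented_group S R\<^esub> (y \<otimes>\<^bsub>presented_group S R\<^esub> z)"
    by (simp only: uv w presented_group_mult app append_assoc)
qed


section \<open>Right-angled Artin groups\<close>

text \<open>A finite simple graph is a \<^locale>\<open>pair_graph\<close>; its symmetric set of arcs contains both
  \<open>(s, t)\<close> and \<open>(t, s)\<close> for each edge \<open>{s, t}\<close>.\<close>

definition raag_relations :: "'a pair_pre_digraph \<Rightarrow> ('a gword \<times> 'a gword) set" where
  "raag_relations \<Gamma> = {([(s, True), (t, True)], [(t, True), (s, True)]) | s t. (s, t) \<in> parcs \<Gamma>}"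

definition raag :: "'a pair_pre_digraph \<Rightarrow> 'a gword set monoid" where
  "raag \<Gamma> = presented_group (pverts \<Gamma>) (raag_relations \<Gamma>)"

definition raag_gens :: "'a pair_pre_digraph \<Rightarrow> 'a gword set set" where
  "raag_gens \<Gamma> = (\<lambda>x. word_class (pverts \<Gamma>) (raag_relations \<Gamma>) [x]) ` (pverts \<Gamma> \<times> UNIV)"

lemma group_raag: "group (raag \<Gamma>)"
  by (simp add: raag_def group_presented_group)


section \<open>Cyclic extensions\<close>

text \<open>The pair \<open>(j, g)\<close> stands for \<open>t\<^sup>j g\<close>; since \<open>t\<^sup>-\<^sup>k g t\<^sup>k = \<phi>\<^sup>k(g)\<close>, we have
  \<open>t\<^sup>j g t\<^sup>k h = t\<^sup>j\<^sup>+\<^sup>k \<phi>\<^sup>k(g) h\<close>.\<close>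

definition cyclic_ext :: "('a, 'b) monoid_scheme \<Rightarrow> ('a \<Rightarrow> 'a) \<Rightarrow> nat \<Rightarrow> (int \<times> 'a) monoid" where
  "cyclic_ext A \<phi> m =
    \<lparr>carrier = carrier (integer_mod_group m) \<times> carrier A,
     monoid.mult = (\<lambda>(j, g) (k, h).
       (j \<otimes>\<^bsub>integer_mod_group m\<^esub> k, (\<phi> [^]\<^bsub>AutoGroup A\<^esub> k) g \<otimes>\<^bsub>A\<^esub> h)),
     one = (\<one>\<^bsub>integer_mod_group m\<^esub>, \<one>\<^bsub>A\<^esub>)\<rparr>"

text \<open>The remainder makes \<open>t\<close> the identity when \<open>m = 1\<close>.\<close>

definition cyclic_ext_t :: "('a, 'b) monoid_scheme \<Rightarrow> nat \<Rightarrow> int \<times> 'a" where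
  "cyclic_ext_t A m = (1 mod int m, \<one>\<^bsub>A\<^esub>)"

lemma auto_group_mult_apply:
  assumes "\<alpha> \<in> auto A" "\<beta> \<in> auto A" "g \<in> carrier A"
  shows "(\<alpha> \<otimes>\<^bsub>AutoGroup A\<^esub> \<beta>) g = \<alpha> (\<beta> g)"
  using assms by (auto simp: AutoGroup_def BijGroup_def auto_def compose_def)

lemma group_cyclic_ext:
  assumes "group A" "\<phi> \<in> auto A" "0 < m" "\<phi> [^]\<^bsub>AutoGroup A\<^esub> m = \<one>\<^bsub>AutoGroup A\<^esub>"
  shows "group (cyclic_ext A \<phi> m)"
proof -
  interpret A: group A by fact
  interpret Au: group "AutoGroup A" by (rule A.AutoGroup)
  interpret Z: group "integer_mod_group m" by simp
  let ?p = "\<lambda>k::int. \<phi> [^]\<^bsub>AutoGroup A\<^esub> k"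
  have car: "carrier (AutoGroup A) = auto A" by (simp add: AutoGroup_def)
  have p: "?p k \<in> auto A" for k
    using Au.int_pow_closed[of \<phi> k] assms(2) by (simp add: car)
  have pc: "?p k g \<in> carrier A" if "g \<in> carrier A" for k g
    using p[of k] that by (auto simp: auto_def hom_def)
  have pm: "?p k (g \<otimes>\<^bsub>A\<^esub> h) = ?p k g \<otimes>\<^bsub>A\<^esub> ?p k h" if "g \<in> carrier A" "h \<in> carrier A" for k g h
    using p[of k] that by (auto simp: auto_def hom_def)
  have p1: "?p k \<one>\<^bsub>A\<^esub> = \<one>\<^bsub>A\<^esub>" for k
    using p[of k] A.group_axioms by (intro hom_one) (auto simp: auto_def)
  have p0: "\<one>\<^bsub>AutoGroup A\<^esub> g = g" if "g \<in> carrier A" for g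
    using that by (simp add: AutoGroup_def BijGroup_def)
  have padd: "?p (j + k) g = ?p j (?p k g)" if "g \<in> carrier A" for j k g
    using auto_group_mult_apply[OF p p that] Au.int_pow_mult[of \<phi> j k] assms(2) by (simp add: car)
  have pmod: "?p (k mod int m) = ?p k" for k
  proof -
    have "?p k = ?p (int m * (k div int m) + k mod int m)" by simp
    also have "\<dots> = ?p (int m * (k div int m)) \<otimes>\<^bsub>AutoGroup A\<^esub> ?p (k mod int m)"
      using assms(2) car by (intro Au.int_pow_mult) auto
    also have "?p (int m * (k div int m)) = \<one>\<^bsub>AutoGroup A\<^esub>"
      using assms(2,4) car by (simp add: Au.int_pow_pow[symmetric] int_pow_int)
    finally show ?thesis using p car by simp
  qed
  show ?thesis
  proof (rule groupI)
    fix x y assume "x \<in> carrier (cyclic_ext A \<phi> m)" "y \<in> carrier (cyclic_ext A \<phi> m)"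
    then show "x \<otimes>\<^bsub>cyclic_ext A \<phi> m\<^esub> y \<in> carrier (cyclic_ext A \<phi> m)"
      using Z.m_closed by (fastforce simp: cyclic_ext_def pc)
  next
    show "\<one>\<^bsub>cyclic_ext A \<phi> m\<^esub> \<in> carrier (cyclic_ext A \<phi> m)"
      by (simp add: cyclic_ext_def)
  next
    fix x y z assume "x \<in> carrier (cyclic_ext A \<phi> m)" "y \<in> carrier (cyclic_ext A \<phi> m)"
      "z \<in> carrier (cyclic_ext A \<phi> m)"
    then show "x \<otimes>\<^bsub>cyclic_ext A \<phi> m\<^esub> y \<otimes>\<^bsub>cyclic_ext A \<phi> m\<^esub> z
        = x \<otimes>\<^bsub>cyclic_ext A \<phi> m\<^esub> (y \<otimes>\<^bsub>cyclic_ext A \<phi> m\<^esub> z)"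
      by (auto simp: cyclic_ext_def pc pm pmod A.m_assoc mod_simps add.assoc
          simp flip: padd) (simp add: add.commute)
  next
    fix x assume x: "x \<in> carrier (cyclic_ext A \<phi> m)"
    then show "\<one>\<^bsub>cyclic_ext A \<phi> m\<^esub> \<otimes>\<^bsub>cyclic_ext A \<phi> m\<^esub> x = x"
      using assms(3) by (auto simp: cyclic_ext_def p1 carrier_integer_mod_group)
    obtain k h where kh: "x = (k, h)" by (cases x)
    have h: "h \<in> carrier A" using x kh by (simp add: cyclic_ext_def)
    have "((- k) mod int m, ?p (- k) (inv\<^bsub>A\<^esub> h)) \<otimes>\<^bsub>cyclic_ext A \<phi> m\<^esub> x = \<one>\<^bsub>cyclic_ext A \<phi> m\<^esub>"
      using h by (simp add: kh cyclic_ext_def padd[symmetric] p0 mod_simps)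
    moreover have "((- k) mod int m, ?p (- k) (inv\<^bsub>A\<^esub> h)) \<in> carrier (cyclic_ext A \<phi> m)"
      using h assms(3) by (simp add: cyclic_ext_def pc carrier_integer_mod_group)
    ultimately show "\<exists>y\<in>carrier (cyclic_ext A \<phi> m). y \<otimes>\<^bsub>cyclic_ext A \<phi> m\<^esub> x = \<one>\<^bsub>cyclic_ext A \<phi> m\<^esub>"
      by blast
  qed
qed

lemma cyclic_ext_conj_t:
  assumes "group A" "\<phi> \<in> auto A" "0 < m" "\<phi> [^]\<^bsub>AutoGroup A\<^esub> m = \<one>\<^bsub>AutoGroup A\<^esub>" "g \<in> carrier A"
  shows "inv\<^bsub>cyclic_ext A \<phi> m\<^esub> cyclic_ext_t A m \<otimes>\<^bsub>cyclic_ext A \<phi> m\<^esub> (0, g)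
    \<otimes>\<^bsub>cyclic_ext A \<phi> m\<^esub> cyclic_ext_t A m = (0, \<phi> g)"
proof -
  interpret A: group A by fact
  interpret Au: group "AutoGroup A" by (rule A.AutoGroup)
  interpret E: group "cyclic_ext A \<phi> m" by (rule group_cyclic_ext[OF assms(1-4)])
  have car: "carrier (AutoGroup A) = auto A" by (simp add: AutoGroup_def)
  have g: "\<phi> g \<in> carrier A" using assms by (auto simp: auto_def hom_def)
  have t: "cyclic_ext_t A m \<in> carrier (cyclic_ext A \<phi> m)"
    using assms(3) by (simp add: cyclic_ext_t_def cyclic_ext_def carrier_integer_mod_group)
  have x: "(0, g) \<in> carrier (cyclic_ext A \<phi> m)" "(0, \<phi> g) \<in> carrier (cyclic_ext A \<phi> m)"
    using assms(5) g by (simp_all add: cyclic_ext_def)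
  have \<phi>: "\<phi> [^]\<^bsub>AutoGroup A\<^esub> (1 mod int m) = \<phi>"
  proof (cases "m = 1")
    case True
    then show ?thesis using assms(2,4) car by simp
  next
    case False
    then have "1 mod int m = 1" using assms(3) by simp
    then show ?thesis using assms(2) car by simp
  qed
  have one: "(\<phi> [^]\<^bsub>AutoGroup A\<^esub> (0::int)) \<one>\<^bsub>A\<^esub> = \<one>\<^bsub>A\<^esub>"
    by (simp add: AutoGroup_def BijGroup_def)
  have "(0, g) \<otimes>\<^bsub>cyclic_ext A \<phi> m\<^esub> cyclic_ext_t A m
      = cyclic_ext_t A m \<otimes>\<^bsub>cyclic_ext A \<phi> m\<^esub> (0, \<phi> g)"
    using \<phi> g one by (simp add: cyclic_ext_def cyclic_ext_t_def)
  then show ?thesis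
    using t x by (simp add: E.m_assoc flip: E.m_assoc[of "inv\<^bsub>cyclic_ext A \<phi> m\<^esub> cyclic_ext_t A m"])
qed


section \<open>Virtual RAAGs\<close>

definition virtual_raag ::
  "'a pair_pre_digraph \<Rightarrow> ('a gword set \<Rightarrow> 'a gword set) \<Rightarrow> nat \<Rightarrow> (int \<times> 'a gword set) monoid" where
  "virtual_raag \<Gamma> \<phi> m = cyclic_ext (raag \<Gamma>) \<phi> m"

definition virtual_raag_gens ::
  "'a pair_pre_digraph \<Rightarrow> ('a gword set \<Rightarrow> 'a gword set) \<Rightarrow> nat \<Rightarrow> (int \<times> 'a gword set) set" where
  "virtual_raag_gens \<Gamma> \<phi> m =
    (\<lambda>x. (0, x)) ` raag_gens \<Gamma> \<union>
    {cyclic_ext_t (raag \<Gamma>) m, inv\<^bsub>virtual_raag \<Gamma> \<phi> m\<^esub> cyclic_ext_t (raag \<Gamma>) m}"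


section \<open>Word length and conjugacy geodesics\<close>

text \<open>Below, \<open>Y\<close> is a finite inverse-closed subset of \<open>carrier G\<close> generating \<open>G\<close>, and words over
  \<open>Y\<close> are lists of elements of \<open>Y\<close>.\<close>

definition word_value :: "('a, 'b) monoid_scheme \<Rightarrow> 'a list \<Rightarrow> 'a" where
  "word_value G w = foldr (\<lambda>y g. y \<otimes>\<^bsub>G\<^esub> g) w \<one>\<^bsub>G\<^esub>"

definition word_length :: "('a, 'b) monoid_scheme \<Rightarrow> 'a set \<Rightarrow> 'a \<Rightarrow> nat" where
  "word_length G Y g = (LEAST n. \<exists>w\<in>lists Y. word_value G w = g \<and> length w = n)"

definition length_preserving :: "('a, 'b) monoid_scheme \<Rightarrow> 'a set \<Rightarrow> ('a \<Rightarrow> 'a) \<Rightarrow> bool" where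
  "length_preserving G Y \<phi> \<longleftrightarrow> (\<forall>g\<in>carrier G. word_length G Y (\<phi> g) = word_length G Y g)"

definition conj_class :: "('a, 'b) monoid_scheme \<Rightarrow> 'a \<Rightarrow> 'a set" where
  "conj_class G g = {x \<otimes>\<^bsub>G\<^esub> g \<otimes>\<^bsub>G\<^esub> inv\<^bsub>G\<^esub> x | x. x \<in> carrier G}"

definition ConjGeo :: "('a, 'b) monoid_scheme \<Rightarrow> 'a set \<Rightarrow> 'a list set" where
  "ConjGeo G Y =
    {w \<in> lists Y. length w = (INF h\<in>conj_class G (word_value G w). word_length G Y h)}"


section \<open>Regular languages\<close>

text \<open>\<open>L\<close> is the language over the finite alphabet \<open>Y\<close> accepted by a deterministic automaton
  with finite state set \<open>Q\<close>, start state \<open>i\<close>, transition function \<open>\<delta>\<close> and accepting states \<open>F\<close>.\<close>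

definition regular_language :: "'a set \<Rightarrow> 'a list set \<Rightarrow> bool" where
  "regular_language Y L \<longleftrightarrow> finite Y \<and>
    (\<exists>(Q :: nat set) i \<delta> F. finite Q \<and> i \<in> Q \<and> (\<forall>q\<in>Q. \<forall>y\<in>Y. \<delta> q y \<in> Q) \<and> F \<subseteq> Q \<and>
      L = {w \<in> lists Y. foldl \<delta> i w \<in> F})"

end

theory Submission
  imports Defs "HOL-Library.Product_Plus"
begin

text \<open>The witness is the free abelian group of rank two, \<open>A = \<langle>a, b | ab = ba\<rangle>\<close>, with the automorphism
  \<open>\<phi>(a) = ab\<close>, \<open>\<phi>(b) = b\<inverse>\<close> of order two. It sends the generator \<open>a\<close> to an element of length two, so it
  does not preserve length. What makes the example tractable is the basis \<open>a, ab\<close> of \<open>A\<close>: the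
  automorphism exchanges its two elements, so \<open>A\<close> extended by \<open>t\<close> is the wreath product of the
  integers with a group of order two. In coordinates \<open>(p, q)\<close> for \<open>a\<^sup>p (ab)\<^sup>q\<close> the generators are
  \<open>a = (1, 0)\<close>, \<open>b = (-1, 1)\<close> and the swap \<open>t\<close>.

  In these coordinates a word is read from left to right as a walk in the plane, in which each \<open>t\<close>
  exchanges the axes for the letters after it. The shortest length in the conjugacy class of
  \<open>(p, q) t\<close> is \<open>|p + q| + 1\<close>, because conjugation moves \<open>(p, q)\<close> freely along the line of constant
  \<open>p + q\<close>. The class of \<open>(p, q)\<close> consists of \<open>(p, q)\<close> and \<open>(q, p)\<close>, and its shortest length is the
  smallest of \<open>|p + q| + |q|\<close>, \<open>|p + q| + |p|\<close> and \<open>|p| + |q| + 2\<close>, attained by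
  \<open>a\<^sup>p\<^sup>+\<^sup>q b\<^sup>q\<close>, \<open>a\<^sup>p\<^sup>+\<^sup>q b\<^sup>p\<close> and \<open>a\<^sup>p t a\<^sup>q t\<close> (\<open>conj_length_attained\<close>, with the lower bound
  \<open>conj_length_le\<close>).

  The value and the length of a word depend only on the number of letters \<open>t\<close> and on how often each of
  the six steps \<open>\<plusminus>(1, 0)\<close>, \<open>\<plusminus>(0, 1)\<close>, \<open>\<plusminus>(-1, 1)\<close> of the walk occurs. Comparing the length with the
  minimum above (\<open>conj_length_eq_iff\<close>) leaves conditions that say which steps may occur together and
  compare the counts with constants up to four, so that the counts capped at four form a finite
  automaton for the conjugacy geodesics. Constants suffice because the third term exceeds
  \<open>|p| + |q|\<close> only by two: if \<open>p\<close> and \<open>q\<close> have the same sign, a conjugacy geodesic without \<open>t\<close>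
  contains at most two letters \<open>b\<^sup>\<plusminus>\<^sup>1\<close>, and comparing its other count with this number is a
  comparison with a constant.\<close>

section \<open>Words in a group and regular languages\<close>

lemma (in group) word_value_closed:
  "w \<in> lists (carrier G) \<Longrightarrow> word_value G w \<in> carrier G"
  by (induction w) (auto simp: word_value_def)

lemma (in group) word_value_snoc:
  "w \<in> lists (carrier G) \<Longrightarrow> y \<in> carrier G \<Longrightarrow>
    word_value G (w @ [y]) = word_value G w \<otimes> y"
proof (induction w)
  case (Cons x w)
  then show ?case
    using word_value_closed[of w] by (simp add: word_value_def m_assoc)
qed (simp add: word_value_def)

lemma word_length_le:
  "w \<in> lists Y \<Longrightarrow> word_length G Y (word_value G w) \<le> length w"
  unfolding word_length_def by (rule Least_le) blast

lemma le_word_length: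
  assumes "g \<in> word_value G ` lists Y"
    and "\<And>w. w \<in> lists Y \<Longrightarrow> word_value G w = g \<Longrightarrow> n \<le> length w"
  shows "n \<le> word_length G Y g"
proof -
  have "\<exists>k. \<exists>w\<in>lists Y. word_value G w = g \<and> length w = k"
    using assms(1) by blast
  from LeastI_ex[OF this] obtain w
    where "w \<in> lists Y" "word_value G w = g" "length w = word_length G Y g"
    unfolding word_length_def by blast
  then show ?thesis
    using assms(2)[of w] by simp
qed

text \<open>A candidate \<open>N\<close> for the minimal length in a conjugacy class is verified by three properties:
  it is a lower bound for the length of every word, it is a class function, and every class contains
  the value of a word of that length. Conjugacy is expressed by \<open>x \<otimes> g = h \<otimes> x\<close> so that users need
  not compute inverses.\<close>
lemma (in group) ConjGeo_eqI:
  fixes N :: "'a \<Rightarrow> nat"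
  assumes gen: "word_value G ` lists Y = carrier G"
    and lower: "\<And>w. w \<in> lists Y \<Longrightarrow> N (word_value G w) \<le> length w"
    and conj: "\<And>x g h. x \<in> carrier G \<Longrightarrow> g \<in> carrier G \<Longrightarrow> h \<in> carrier G \<Longrightarrow>
      x \<otimes> g = h \<otimes> x \<Longrightarrow> N h = N g"
    and attained: "\<And>g. g \<in> carrier G \<Longrightarrow>
      \<exists>x\<in>carrier G. \<exists>w\<in>lists Y. x \<otimes> g = word_value G w \<otimes> x \<and> length w = N g"
  shows "ConjGeo G Y = {w \<in> lists Y. length w = N (word_value G w)}"
proof -
  have "(INF h\<in>conj_class G g. word_length G Y h) = N g" if g: "g \<in> carrier G" for g
  proof (rule antisym)
    obtain x w where x: "x \<in> carrier G" and w: "w \<in> lists Y" "length w = N g"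
      and eq: "x \<otimes> g = word_value G w \<otimes> x"
      using attained[OF g] by blast
    have "word_value G w \<in> carrier G"
      using gen w by blast
    then have "word_value G w = x \<otimes> g \<otimes> inv x"
      using x eq by (simp add: m_assoc)
    then have "word_value G w \<in> conj_class G g"
      using x by (auto simp: conj_class_def)
    then have "(INF h\<in>conj_class G g. word_length G Y h) \<le> word_length G Y (word_value G w)"
      by (intro cINF_lower) auto
    also have "\<dots> \<le> N g"
      using word_length_le[OF w(1), of G] w(2) by simp
    finally show "(INF h\<in>conj_class G g. word_length G Y h) \<le> N g" .
  next
    have "N g \<le> word_length G Y h" if "h \<in> conj_class G g" for h
    proof -
      obtain x where x: "x \<in> carrier G" "h = x \<otimes> g \<otimes> inv x"
        using \<open>h \<in> conj_class G g\<close> by (auto simp: conj_class_def)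
      then have h: "h \<in> carrier G" "x \<otimes> g = h \<otimes> x"
        using g by (simp_all add: m_assoc)
      have "h \<in> word_value G ` lists Y"
        using gen h by simp
      then have "N h \<le> word_length G Y h"
        by (rule le_word_length) (use lower in blast)
      then show ?thesis
        using conj[OF x(1) g h] by simp
    qed
    moreover have "conj_class G g \<noteq> {}"
      using g by (auto simp: conj_class_def)
    ultimately show "N g \<le> (INF h\<in>conj_class G g. word_length G Y h)"
      by (intro cINF_greatest) auto
  qed
  moreover have "word_value G w \<in> carrier G" if "w \<in> lists Y" for w
    using gen that by blast
  ultimately have "(INF h\<in>conj_class G (word_value G w). word_length G Y h) = N (word_value G w)"
    if "w \<in> lists Y" for w
    using that by blast
  then show ?thesis
    unfolding ConjGeo_def by (metis (no_types, lifting))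
qed

text \<open>The Myhill--Nerode criterion: a summary of words that takes finitely many values, that can be
  updated letter by letter and that decides membership is a deterministic automaton, up to
  numbering its values by natural numbers.\<close>
lemma regular_languageI:
  fixes f :: "'a list \<Rightarrow> 's"
  assumes Y: "finite Y" and fin: "finite (f ` lists Y)"
    and step: "\<And>w y. w \<in> lists Y \<Longrightarrow> y \<in> Y \<Longrightarrow> f (w @ [y]) = \<delta> (f w) y"
    and L: "\<And>w. w \<in> lists Y \<Longrightarrow> w \<in> L \<longleftrightarrow> P (f w)" and sub: "L \<subseteq> lists Y"
  shows "regular_language Y L"
proof -
  let ?S = "f ` lists Y"
  obtain h :: "'s \<Rightarrow> nat" where h: "inj_on h ?S"
    using finite_imp_inj_to_nat_seg[OF fin] by blast
  let ?d = "\<lambda>q y. h (\<delta> (inv_into ?S h q) y)"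
  have d: "?d (h (f w)) y = h (f (w @ [y]))" if "w \<in> lists Y" "y \<in> Y" for w y
    using that h by (simp add: inv_into_f_f step)
  have run: "foldl ?d (h (f [])) w = h (f w)" if "w \<in> lists Y" for w
    using that
  proof (induction w rule: rev_induct)
    case (snoc y w)
    then show ?case using d[of w y] by simp
  qed simp
  have acc: "h (f w) \<in> h ` {s \<in> ?S. P s} \<longleftrightarrow> P (f w)" if "w \<in> lists Y" for w
  proof
    assume "h (f w) \<in> h ` {s \<in> ?S. P s}"
    then obtain v where "v \<in> lists Y" "h (f w) = h (f v)" "P (f v)"
      by blast
    then have "f w = f v"
      using that by (intro inj_onD[OF h]) auto
    then show "P (f w)"
      using \<open>P (f v)\<close> by simp
  qed (use that in blast)
  have closed: "?d q y \<in> h ` ?S" if "q \<in> h ` ?S" "y \<in> Y" for q y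
  proof -
    obtain w where w: "w \<in> lists Y" "q = h (f w)"
      using \<open>q \<in> h ` ?S\<close> by blast
    moreover have "w @ [y] \<in> lists Y" using w \<open>y \<in> Y\<close> by simp
    ultimately show ?thesis using d[of w y] \<open>y \<in> Y\<close> by blast
  qed
  have lang: "w \<in> L \<longleftrightarrow> w \<in> lists Y \<and> foldl ?d (h (f [])) w \<in> h ` {s \<in> ?S. P s}" for w
  proof (cases "w \<in> lists Y")
    case True
    then show ?thesis by (simp only: run[OF True] acc[OF True] L[OF True] simp_thms)
  qed (use sub in blast)
  show ?thesis
    unfolding regular_language_def
  proof (intro conjI exI)
    show "finite Y" "finite (h ` ?S)" using Y fin by auto
    show "h (f []) \<in> h ` ?S" by blast
    show "\<forall>q\<in>h ` ?S. \<forall>y\<in>Y. ?d q y \<in> h ` ?S" using closed by blast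
    show "h ` {s \<in> ?S. P s} \<subseteq> h ` ?S" by blast
    show "L = {w \<in> lists Y. foldl ?d (h (f [])) w \<in> h ` {s \<in> ?S. P s}}"
      by (intro Set.set_eqI) (simp only: lang mem_Collect_eq)
  qed
qed

lemma regular_language_image:
  assumes reg: "regular_language Y L" and inj: "inj_on E Y"
  shows "regular_language (E ` Y) (map E ` L)"
proof -
  obtain Q :: "nat set" and i \<delta> F where Y: "finite Y" and Q: "finite Q" "i \<in> Q"
    and d: "\<forall>q\<in>Q. \<forall>y\<in>Y. \<delta> q y \<in> Q" and F: "F \<subseteq> Q"
    and L: "L = {w \<in> lists Y. foldl \<delta> i w \<in> F}"
    using reg unfolding regular_language_def by blast
  let ?D = "inv_into Y E"
  have run: "foldl (\<lambda>q z. \<delta> q (?D z)) i (map E w) = foldl \<delta> i w" if "w \<in> lists Y" for w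
    using that by (induction w rule: rev_induct) (simp_all add: inv_into_f_f[OF inj])
  have im: "map E ` L = {w \<in> lists (E ` Y). foldl (\<lambda>q z. \<delta> q (?D z)) i w \<in> F}" (is "_ = ?R")
  proof (intro Set.set_eqI iffI)
    fix w assume "w \<in> map E ` L"
    then obtain v where "v \<in> lists Y" "foldl \<delta> i v \<in> F" "w = map E v"
      unfolding L by blast
    then show "w \<in> ?R"
      using run[of v] by auto
  next
    fix w assume w: "w \<in> ?R"
    then have "w \<in> map E ` lists Y"
      unfolding lists_image[symmetric] by blast
    then obtain v where v: "v \<in> lists Y" "w = map E v"
      by blast
    then have "foldl \<delta> i v \<in> F"
      using w run[OF v(1)] by simp
    then show "w \<in> map E ` L"
      unfolding L using v by blast
  qed
  have "\<forall>q\<in>Q. \<forall>z\<in>E ` Y. \<delta> q (?D z) \<in> Q"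
    using d by (simp add: inv_into_f_f[OF inj])
  then show ?thesis
    unfolding regular_language_def using Y Q F im
    by (intro conjI exI[of _ Q] exI[of _ i] exI[of _ "\<lambda>q z. \<delta> q (?D z)"] exI[of _ F])
      simp_all
qed

section \<open>The free abelian group of rank two\<close>

lemma word_class_eq_iff:
  assumes "u \<in> lists (S \<times> UNIV)" "v \<in> lists (S \<times> UNIV)"
  shows "word_class S R u = word_class S R v \<longleftrightarrow> (u, v) \<in> word_eq S R"
  unfolding word_class_def using eq_equiv_class_iff[OF equiv_word_eq assms] .

lemma word_class_inverse:
  assumes "s \<in> S"
  shows "word_class S R [(s, False)] = inv\<^bsub>presented_group S R\<^esub> word_class S R [(s, True)]"
proof -
  interpret group "presented_group S R" by (rule group_presented_group)
  have "([] @ [(s, False), (s, \<not> False)] @ [], [] @ []) \<in> word_eq S R"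
    using assms by (intro word_eq.cancel) auto
  then have "word_class S R [(s, False), (s, True)] = word_class S R []"
    using assms by (subst word_class_eq_iff) auto
  then have "word_class S R [(s, False)] \<otimes>\<^bsub>presented_group S R\<^esub> word_class S R [(s, True)]
      = \<one>\<^bsub>presented_group S R\<^esub>"
    using assms by (simp add: presented_group_mult) (simp add: presented_group_def)
  then show ?thesis
    using assms by (intro inv_equality[symmetric]) (auto simp: carrier_presented_group)
qed

lemma (in group) commute_inv:
  assumes "x \<in> carrier G" "y \<in> carrier G" "x \<otimes> y = y \<otimes> x"
  shows "inv x \<otimes> y = y \<otimes> inv x"
proof -
  have "inv x \<otimes> y = inv x \<otimes> (y \<otimes> x) \<otimes> inv x"
    using assms(1,2) by (simp add: m_assoc)
  also have "\<dots> = y \<otimes> inv x"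
    using assms(1,2) by (simp add: assms(3)[symmetric] m_assoc[symmetric])
  finally show ?thesis .
qed

text \<open>Commutation of the generators passes to their inverses by \<open>commute_inv\<close>, then to a
  letter against a word and to a word against a word by induction.\<close>
lemma comm_group_presented_group:
  assumes comm: "\<And>s t. s \<in> S \<Longrightarrow> t \<in> S \<Longrightarrow>
    ([(s, True), (t, True)], [(t, True), (s, True)]) \<in> word_eq S R"
  shows "comm_group (presented_group S R)"
proof -
  let ?P = "presented_group S R"
  let ?c = "word_class S R"
  interpret group ?P by (rule group_presented_group)
  have car: "?c u \<in> carrier ?P" if "u \<in> lists (S \<times> UNIV)" for u
    using that by (auto simp: carrier_presented_group)
  have pos: "?c [(s, True)] \<otimes>\<^bsub>?P\<^esub> ?c [(t, True)] = ?c [(t, True)] \<otimes>\<^bsub>?P\<^esub> ?c [(s, True)]"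
    if "s \<in> S" "t \<in> S" for s t
    using that comm[OF that] by (simp add: presented_group_mult word_class_eq_iff)
  have letter: "?c [(s, b)] \<otimes>\<^bsub>?P\<^esub> ?c [(t, b')] = ?c [(t, b')] \<otimes>\<^bsub>?P\<^esub> ?c [(s, b)]"
    if st: "s \<in> S" "t \<in> S" for s t b b'
  proof -
    have cs: "?c [(s, b)] \<in> carrier ?P" "?c [(t, b)] \<in> carrier ?P" for b
      using st by (auto intro!: car)
    have "?c [(s, b)] \<otimes>\<^bsub>?P\<^esub> ?c [(t, True)] = ?c [(t, True)] \<otimes>\<^bsub>?P\<^esub> ?c [(s, b)]"
      using pos[OF st] commute_inv[OF cs(1) cs(2) pos[OF st]] word_class_inverse[OF st(1), of R]
      by (cases b) simp_all
    then show ?thesis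
      using commute_inv[OF cs(2)[of True] cs(1)[of b]] word_class_inverse[OF st(2), of R]
      by (cases b') simp_all
  qed
  have cons_eq: "?c (x # u) = ?c [x] \<otimes>\<^bsub>?P\<^esub> ?c u"
    if "x \<in> S \<times> UNIV" "u \<in> lists (S \<times> UNIV)" for x u
    using that by (subst presented_group_mult) auto
  have nil_eq: "?c [] = \<one>\<^bsub>?P\<^esub>" by (simp add: presented_group_def)
  have one_word: "?c [x] \<otimes>\<^bsub>?P\<^esub> ?c v = ?c v \<otimes>\<^bsub>?P\<^esub> ?c [x]"
    if x: "x \<in> S \<times> UNIV" and v: "v \<in> lists (S \<times> UNIV)" for x v
    using v
  proof (induction v)
    case Nil
    then show ?case using x car[of "[x]"] by (simp add: nil_eq)
  next
    case (Cons y v)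
    have c: "?c [x] \<in> carrier ?P" "?c [y] \<in> carrier ?P" "?c v \<in> carrier ?P"
      using x Cons by (auto intro!: car)
    have "?c [x] \<otimes>\<^bsub>?P\<^esub> (?c [y] \<otimes>\<^bsub>?P\<^esub> ?c v) = ?c [y] \<otimes>\<^bsub>?P\<^esub> (?c [x] \<otimes>\<^bsub>?P\<^esub> ?c v)"
      using letter[of "fst x" "fst y" "snd x" "snd y"] x Cons.hyps c
      by (auto simp: m_assoc[symmetric])
    then show ?case
      using c Cons by (simp add: cons_eq[of y v] m_assoc)
  qed
  have "?c u \<otimes>\<^bsub>?P\<^esub> ?c v = ?c v \<otimes>\<^bsub>?P\<^esub> ?c u"
    if u: "u \<in> lists (S \<times> UNIV)" and v: "v \<in> lists (S \<times> UNIV)" for u v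
    using u
  proof (induction u)
    case Nil
    then show ?case using v car[of v] by (simp add: nil_eq)
  next
    case (Cons x u)
    have c: "?c [x] \<in> carrier ?P" "?c u \<in> carrier ?P" "?c v \<in> carrier ?P"
      using v Cons by (auto intro!: car)
    have "?c [x] \<otimes>\<^bsub>?P\<^esub> ?c v = ?c v \<otimes>\<^bsub>?P\<^esub> ?c [x]"
      using one_word Cons.hyps v by blast
    then have "?c [x] \<otimes>\<^bsub>?P\<^esub> (?c v \<otimes>\<^bsub>?P\<^esub> ?c u) = ?c v \<otimes>\<^bsub>?P\<^esub> (?c [x] \<otimes>\<^bsub>?P\<^esub> ?c u)"
      using c by (simp add: m_assoc[symmetric])
    then show ?case
      using c Cons by (simp add: cons_eq[of x u] m_assoc)
  qed
  then show ?thesis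
    by (intro group_comm_groupI) (auto simp: carrier_presented_group)
qed

definition edge_graph :: "nat pair_pre_digraph" where
  "edge_graph = \<lparr>pverts = {0, 1}, parcs = {(0, 1), (1, 0)}\<rparr>"

lemma pair_graph_edge_graph: "pair_graph edge_graph"
  by unfold_locales (auto simp: edge_graph_def arc_to_ends_def sym_def symmetric_def)

abbreviation edge_class :: "nat gword \<Rightarrow> nat gword set" where
  "edge_class \<equiv> word_class {0, 1} (raag_relations edge_graph)"

lemma raag_edge_graph: "raag edge_graph = presented_group {0, 1} (raag_relations edge_graph)"
  by (simp add: raag_def edge_graph_def)

lemma raag_gens_edge_graph:
  "raag_gens edge_graph = (\<lambda>x. edge_class [x]) ` ({0, 1} \<times> UNIV)"
  by (simp add: raag_gens_def edge_graph_def)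

lemma comm_group_raag_edge_graph: "comm_group (raag edge_graph)"
  unfolding raag_edge_graph
proof (rule comm_group_presented_group)
  let ?R = "raag_relations edge_graph"
  fix s t :: nat
  assume st: "s \<in> {0, 1}" "t \<in> {0, 1}"
  have "([] @ [(s, True), (t, True)] @ [], [] @ [(t, True), (s, True)] @ []) \<in> word_eq {0, 1} ?R"
    if "s \<noteq> t"
    by (rule word_eq.rel) (use st that in \<open>auto simp: raag_relations_def edge_graph_def\<close>)
  then show "([(s, True), (t, True)], [(t, True), (s, True)]) \<in> word_eq {0, 1} ?R"
    using st by (cases "s = t") (auto intro: word_eq.refl)
qed

interpretation Z2: comm_group "raag edge_graph"
  by (rule comm_group_raag_edge_graph)

text \<open>The vertex \<open>0\<close> is the generator \<open>a\<close> and the vertex \<open>1\<close> is \<open>b\<close>. Coordinates refer to the basis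
  \<open>a\<close>, \<open>ab\<close>, in which \<open>b = a\<inverse> (ab)\<close> is \<open>(-1, 1)\<close>.\<close>
definition letter_vec :: "nat \<times> bool \<Rightarrow> int \<times> int" where
  "letter_vec x = (if snd x then id else uminus) (if fst x = 0 then (1, 0) else (- 1, 1))"

definition edge_vec :: "nat gword \<Rightarrow> int \<times> int" where
  "edge_vec u = sum_list (map letter_vec u)"

text \<open>In terms of \<open>a\<close> and \<open>b\<close>, the element \<open>a\<^sup>p (ab)\<^sup>q\<close> is \<open>a\<^sup>p\<^sup>+\<^sup>q b\<^sup>q\<close>.\<close>
definition edge_elt :: "int \<times> int \<Rightarrow> nat gword set" where
  "edge_elt v = edge_class [(0, True)] [^]\<^bsub>raag edge_graph\<^esub> (fst v + snd v)
    \<otimes>\<^bsub>raag edge_graph\<^esub> edge_class [(1, True)] [^]\<^bsub>raag edge_graph\<^esub> snd v"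

lemma edge_vec_Nil: "edge_vec [] = 0"
  by (simp add: edge_vec_def)

lemma edge_vec_Cons: "edge_vec (x # u) = letter_vec x + edge_vec u"
  by (simp add: edge_vec_def)

lemma edge_vec_append: "edge_vec (u @ v) = edge_vec u + edge_vec v"
  by (simp add: edge_vec_def)

lemma edge_class_closed: "u \<in> lists ({0, 1} \<times> UNIV) \<Longrightarrow> edge_class u \<in> carrier (raag edge_graph)"
  by (auto simp: raag_edge_graph carrier_presented_group)

lemma edge_elt_closed: "edge_elt v \<in> carrier (raag edge_graph)"
  unfolding edge_elt_def
  by (intro Z2.m_closed Z2.int_pow_closed edge_class_closed) auto

lemma edge_elt_add: "edge_elt (v + w) = edge_elt v \<otimes>\<^bsub>raag edge_graph\<^esub> edge_elt w"
proof -
  have c: "edge_class [(0, True)] \<in> carrier (raag edge_graph)"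
    "edge_class [(1, True)] \<in> carrier (raag edge_graph)"
    by (intro edge_class_closed; simp)+
  have "fst (v + w) + snd (v + w) = (fst v + snd v) + (fst w + snd w)"
    by simp
  then show ?thesis
    using c unfolding edge_elt_def by (simp only: Z2.int_pow_mult snd_add) (simp add: Z2.m_ac)
qed

lemma edge_elt_zero: "edge_elt 0 = \<one>\<^bsub>raag edge_graph\<^esub>"
  by (simp add: edge_elt_def)

lemma edge_elt_letter:
  assumes "x \<in> {0, 1} \<times> UNIV"
  shows "edge_elt (letter_vec x) = edge_class [x]"
proof -
  have c: "edge_class [(s, b)] \<in> carrier (raag edge_graph)" if "s \<in> {0, 1}" for s b
    using that by (intro edge_class_closed) auto
  have i: "edge_class [(s, False)] = inv\<^bsub>raag edge_graph\<^esub> edge_class [(s, True)]" if "s \<in> {0, 1}" for s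
    unfolding raag_edge_graph by (rule word_class_inverse[OF that])
  show ?thesis
    using assms c i by (auto simp: edge_elt_def letter_vec_def Z2.int_pow_neg)
qed

text \<open>Together with the next lemma, this says that two words are equal in the group exactly if
  their vectors agree: every word is brought to the normal form \<open>a\<^sup>p\<^sup>+\<^sup>q b\<^sup>q\<close>, and each defining relation
  preserves the vector.\<close>
lemma edge_class_eq:
  "u \<in> lists ({0, 1} \<times> UNIV) \<Longrightarrow> edge_class u = edge_elt (edge_vec u)"
proof (induction u rule: lists.induct)
  case Nil
  then show ?case
    by (simp add: edge_vec_Nil edge_elt_zero raag_edge_graph presented_group_def)
next
  case (Cons x u)
  have "edge_class (x # u) = edge_class [x] \<otimes>\<^bsub>raag edge_graph\<^esub> edge_class u"
    unfolding raag_edge_graph using Cons by (subst presented_group_mult) auto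
  then show ?case
    using Cons by (simp only: edge_vec_Cons edge_elt_add edge_elt_letter)
qed

lemma edge_vec_word_eq:
  "(u, v) \<in> word_eq {0, 1} (raag_relations edge_graph) \<Longrightarrow> edge_vec u = edge_vec v"
proof (induction rule: word_eq.induct)
  case (cancel s u v b)
  have "letter_vec (s, b) + letter_vec (s, \<not> b) = 0"
    by (simp add: letter_vec_def zero_prod_def)
  then show ?case
    by (simp add: edge_vec_append edge_vec_Cons edge_vec_Nil)
next
  case (rel p q u v)
  then obtain s t where "p = [(s, True), (t, True)]" "q = [(t, True), (s, True)]"
    by (auto simp: raag_relations_def)
  then show ?case
    by (simp add: edge_vec_append edge_vec_Cons add_ac)
qed simp_all

lemma ex_edge_vec: "\<exists>u\<in>lists ({0, 1} \<times> UNIV). edge_vec u = v"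
proof -
  let ?u = "replicate (nat \<bar>fst v + snd v\<bar>) (0, 0 \<le> fst v + snd v) @
    replicate (nat \<bar>snd v\<bar>) (1, 0 \<le> snd v)"
  have rep: "sum_list (replicate n (x :: int \<times> int)) = (int n * fst x, int n * snd x)" for n x
    by (induction n) (auto simp: zero_prod_def plus_prod_def distrib_right prod_eq_iff)
  have "edge_vec ?u = v"
    by (simp add: edge_vec_def rep letter_vec_def prod_eq_iff)
  moreover have "?u \<in> lists ({0, 1} \<times> UNIV)"
    by auto
  ultimately show ?thesis by blast
qed

lemma inj_edge_elt: "inj edge_elt"
proof (rule injI)
  fix v w
  assume eq: "edge_elt v = edge_elt w"
  obtain u u' where u: "u \<in> lists ({0, 1} \<times> UNIV)" "edge_vec u = v"
    and u': "u' \<in> lists ({0, 1} \<times> UNIV)" "edge_vec u' = w"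
    using ex_edge_vec by metis
  then have "edge_class u = edge_class u'"
    using eq by (simp only: edge_class_eq)
  then have "(u, u') \<in> word_eq {0, 1} (raag_relations edge_graph)"
    using word_class_eq_iff[OF u(1) u'(1)] by simp
  then show "v = w"
    using edge_vec_word_eq u u' by blast
qed

lemma carrier_raag_edge_graph: "carrier (raag edge_graph) = range edge_elt"
proof
  show "carrier (raag edge_graph) \<subseteq> range edge_elt"
    unfolding raag_edge_graph carrier_presented_group using edge_class_eq by blast
qed (auto intro: edge_elt_closed)

lemma raag_gens_eq:
  "raag_gens edge_graph = edge_elt ` {(1, 0), (- 1, 0), (- 1, 1), (1, - 1)}"
proof -
  have "raag_gens edge_graph = edge_elt ` letter_vec ` ({0, 1} \<times> UNIV)"
    unfolding raag_gens_edge_graph image_image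
    by (rule image_cong) (simp_all only: edge_elt_letter)
  also have "letter_vec ` ({0, 1} \<times> UNIV) = {(1, 0), (- 1, 0), (- 1, 1), (1, - 1)}"
    by (simp add: UNIV_bool Sigma_def letter_vec_def insert_commute)
  finally show ?thesis .
qed

section \<open>The swap automorphism\<close>

definition edge_swap :: "nat gword set \<Rightarrow> nat gword set" where
  "edge_swap = (\<lambda>g\<in>carrier (raag edge_graph). edge_elt (prod.swap (inv_into UNIV edge_elt g)))"

lemma edge_swap_elt: "edge_swap (edge_elt v) = edge_elt (prod.swap v)"
  by (simp add: edge_swap_def edge_elt_closed inj_edge_elt)

lemma edge_swap_auto: "edge_swap \<in> auto (raag edge_graph)"
proof -
  have "edge_swap \<in> hom (raag edge_graph) (raag edge_graph)"
  proof (rule homI)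
    fix x y
    assume "x \<in> carrier (raag edge_graph)" "y \<in> carrier (raag edge_graph)"
    then obtain v w where "x = edge_elt v" "y = edge_elt w"
      by (auto simp: carrier_raag_edge_graph)
    then show "edge_swap (x \<otimes>\<^bsub>raag edge_graph\<^esub> y) =
        edge_swap x \<otimes>\<^bsub>raag edge_graph\<^esub> edge_swap y"
      by (simp add: edge_swap_elt flip: edge_elt_add) (simp add: prod.swap_def)
  qed (auto simp: carrier_raag_edge_graph edge_swap_elt)
  moreover have "bij_betw edge_swap (carrier (raag edge_graph)) (carrier (raag edge_graph))"
    by (rule bij_betw_byWitness[where f' = edge_swap])
      (auto simp: carrier_raag_edge_graph edge_swap_elt)
  ultimately show ?thesis
    by (simp add: auto_def Bij_def edge_swap_def)
qed

lemma one_AutoGroup_apply: "x \<in> carrier G \<Longrightarrow> \<one>\<^bsub>AutoGroup G\<^esub> x = x"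
  by (simp add: AutoGroup_def BijGroup_def)

lemma edge_swap_closed: "edge_swap \<in> carrier (AutoGroup (raag edge_graph))"
  using edge_swap_auto by (simp add: AutoGroup_def)

lemma edge_swap_order: "edge_swap [^]\<^bsub>AutoGroup (raag edge_graph)\<^esub> (2 :: nat) = \<one>\<^bsub>AutoGroup (raag edge_graph)\<^esub>"
proof -
  let ?A = "AutoGroup (raag edge_graph)"
  interpret Au: group ?A by (rule Z2.AutoGroup)
  have "edge_swap [^]\<^bsub>?A\<^esub> (2 :: nat) = edge_swap \<otimes>\<^bsub>?A\<^esub> edge_swap"
    using edge_swap_closed by (simp add: numeral_2_eq_2)
  also have "\<dots> = compose (carrier (raag edge_graph)) edge_swap edge_swap"
    using edge_swap_auto by (simp add: AutoGroup_def BijGroup_def auto_def)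
  also have "\<dots> = \<one>\<^bsub>?A\<^esub>"
    by (rule ext)
      (auto simp: AutoGroup_def BijGroup_def compose_def restrict_def carrier_raag_edge_graph
        edge_swap_elt)
  finally show ?thesis .
qed

text \<open>The generator \<open>a\<close> is sent to \<open>ab\<close>. No word shorter than \<open>|p + q| + |q|\<close> represents
  \<open>a\<^sup>p\<^sup>+\<^sup>q b\<^sup>q\<close>, since one letter changes the exponent of only one of \<open>a\<close>, \<open>b\<close>, and by one; for \<open>ab\<close>
  this bound is two.\<close>
lemma edge_swap_not_length_preserving:
  "\<not> length_preserving (raag edge_graph) (raag_gens edge_graph) edge_swap"
proof
  let ?G = "raag edge_graph" and ?Y = "raag_gens edge_graph"
  let ?V = "{(1, 0), (- 1, 0), (- 1, 1), (1, - 1)} :: (int \<times> int) set"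
  assume lp: "length_preserving ?G ?Y edge_swap"
  have one: "word_value ?G [edge_elt (1, 0)] = edge_elt (1, 0)"
    by (simp add: word_value_def edge_elt_closed)
  have "word_length ?G ?Y (edge_elt (1, 0)) \<le> 1"
    using word_length_le[of "[edge_elt (1, 0)]" ?Y ?G] one by (simp add: raag_gens_eq)
  moreover have "2 \<le> word_length ?G ?Y (edge_elt (0, 1))"
  proof (rule le_word_length)
    have "word_value ?G [edge_elt (1, 0), edge_elt (- 1, 1)] = edge_elt (0, 1)"
      by (simp add: word_value_def edge_elt_closed flip: edge_elt_add)
    then show "edge_elt (0, 1) \<in> word_value ?G ` lists ?Y"
      by (intro image_eqI[of _ _ "[edge_elt (1, 0), edge_elt (- 1, 1)]"]) (auto simp: raag_gens_eq)
  next
    fix w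
    assume "w \<in> lists ?Y" and "word_value ?G w = edge_elt (0, 1)"
    moreover have "\<exists>v. word_value ?G w = edge_elt v \<and> \<bar>fst v + snd v\<bar> + \<bar>snd v\<bar> \<le> int (length w)"
      if "w \<in> lists ?Y" for w
      using that
    proof (induction w rule: lists.induct)
      case Nil
      show ?case
        by (intro exI[of _ 0]) (simp add: word_value_def edge_elt_zero)
    next
      case (Cons y w)
      then obtain v u where "word_value ?G w = edge_elt v"
        and le: "\<bar>fst v + snd v\<bar> + \<bar>snd v\<bar> \<le> int (length w)"
        and u: "y = edge_elt u" "u \<in> ?V"
        by (auto simp: raag_gens_eq)
      then have "word_value ?G (y # w) = edge_elt (u + v)"
        by (simp add: word_value_def edge_elt_add)
      moreover have "\<bar>fst (u + v) + snd (u + v)\<bar> + \<bar>snd (u + v)\<bar> \<le> int (length (y # w))"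
        using le u(2) by auto
      ultimately show ?case by blast
    qed
    ultimately obtain v where "edge_elt v = edge_elt (0, 1)"
      "\<bar>fst v + snd v\<bar> + \<bar>snd v\<bar> \<le> int (length w)"
      by metis
    then show "2 \<le> length w"
      using injD[OF inj_edge_elt, of v "(0, 1)"] by simp
  qed
  moreover have "word_length ?G ?Y (edge_swap (edge_elt (1, 0))) = word_length ?G ?Y (edge_elt (1, 0))"
    using lp edge_elt_closed by (simp add: length_preserving_def)
  ultimately show False
    by (simp add: edge_swap_elt)
qed

section \<open>The extension as a wreath product\<close>

text \<open>The extension stores \<open>t\<^sup>j g\<close> as \<open>(j, g)\<close>. Writing the elements as \<open>v t\<^sup>j\<close> instead, with the
  vector in front, makes right multiplication by a letter \<open>u\<close> the addition of \<open>u\<close> twisted by the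
  current parity \<open>j\<close>, so that a word can be evaluated from left to right. Since
  \<open>v t\<^sup>j = t\<^sup>j \<phi>\<^sup>j(v)\<close>, passing between the two forms twists the vector by \<open>j\<close>.\<close>
definition twist :: "bool \<Rightarrow> int \<times> int \<Rightarrow> int \<times> int" where
  "twist j v = (if j then prod.swap v else v)"

definition wreath_mult :: "bool \<times> int \<times> int \<Rightarrow> bool \<times> int \<times> int \<Rightarrow> bool \<times> int \<times> int" where
  "wreath_mult g h = (fst g \<noteq> fst h, snd g + twist (fst g) (snd h))"

definition wreath_elt :: "bool \<times> int \<times> int \<Rightarrow> int \<times> nat gword set" where
  "wreath_elt g = (of_bool (fst g), edge_elt (twist (fst g) (snd g)))"

abbreviation wreath_group :: "(int \<times> nat gword set) monoid" where
  "wreath_group \<equiv> virtual_raag edge_graph edge_swap 2"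

interpretation W: group wreath_group
  unfolding virtual_raag_def
  using edge_swap_auto edge_swap_order by (intro group_cyclic_ext) (simp_all add: group_raag)

lemma twist_simps:
  "twist j (twist k v) = twist (j \<noteq> k) v" "twist j (v + w) = twist j v + twist j w"
  "twist j 0 = 0"
  by (auto simp: twist_def prod_eq_iff)

lemma edge_swap_pow:
  "(edge_swap [^]\<^bsub>AutoGroup (raag edge_graph)\<^esub> (of_bool j :: int)) (edge_elt v) = edge_elt (twist j v)"
proof -
  interpret Au: group "AutoGroup (raag edge_graph)" by (rule Z2.AutoGroup)
  show ?thesis
    using edge_swap_closed
    by (cases j) (simp_all add: twist_def edge_swap_elt one_AutoGroup_apply edge_elt_closed)
qed

lemma wreath_elt_mult:
  "wreath_elt (wreath_mult g h) = wreath_elt g \<otimes>\<^bsub>wreath_group\<^esub> wreath_elt h"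
proof -
  have "(of_bool (fst g) + of_bool (fst h)) mod 2 = (of_bool (fst g \<noteq> fst h) :: int)"
    by (cases "fst g"; cases "fst h") simp_all
  then show ?thesis
    by (simp add: wreath_elt_def wreath_mult_def virtual_raag_def cyclic_ext_def edge_swap_pow
        twist_simps edge_elt_add) (cases "fst g"; cases "fst h"; simp)
qed

lemma inj_wreath_elt: "inj wreath_elt"
  by (rule injI)
    (auto simp: wreath_elt_def twist_def prod_eq_iff of_bool_eq_iff dest!: injD[OF inj_edge_elt])

lemma carrier_wreath_group: "carrier wreath_group = range wreath_elt"
proof
  show "carrier wreath_group \<subseteq> range wreath_elt"
  proof
    fix x
    assume "x \<in> carrier wreath_group"
    then obtain k v where x: "x = (k, edge_elt v)" "k \<in> {0..<2}"
      by (auto simp: virtual_raag_def cyclic_ext_def carrier_integer_mod_group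
          carrier_raag_edge_graph)
    then have "x = wreath_elt (k = 1, twist (k = 1) v)"
      by (auto simp: wreath_elt_def twist_def)
    then show "x \<in> range wreath_elt" by blast
  qed
qed (auto simp: wreath_elt_def virtual_raag_def cyclic_ext_def carrier_integer_mod_group
    edge_elt_closed)

lemma wreath_elt_one: "wreath_elt (False, 0) = \<one>\<^bsub>wreath_group\<^esub>"
  by (simp add: wreath_elt_def twist_def virtual_raag_def cyclic_ext_def edge_elt_zero)

definition wreath_gens :: "(bool \<times> int \<times> int) set" where
  "wreath_gens = {(False, 1, 0), (False, - 1, 0), (False, - 1, 1), (False, 1, - 1), (True, 0)}"

lemma virtual_raag_gens_eq: "virtual_raag_gens edge_graph edge_swap 2 = wreath_elt ` wreath_gens"
proof -
  let ?t = "wreath_elt (True, 0)"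
  have t: "cyclic_ext_t (raag edge_graph) 2 = ?t"
    by (simp add: cyclic_ext_t_def wreath_elt_def twist_simps edge_elt_zero)
  have "?t \<otimes>\<^bsub>wreath_group\<^esub> ?t = \<one>\<^bsub>wreath_group\<^esub>"
    by (simp add: wreath_elt_mult[symmetric] wreath_elt_one[symmetric] wreath_mult_def twist_simps)
  then have i: "inv\<^bsub>wreath_group\<^esub> ?t = ?t"
    by (intro W.inv_equality) (auto simp: carrier_wreath_group)
  show ?thesis
    unfolding virtual_raag_gens_def t i
    by (simp add: raag_gens_eq wreath_gens_def) (auto simp: wreath_elt_def twist_def)
qed

definition wreath_value :: "(bool \<times> int \<times> int) list \<Rightarrow> bool \<times> int \<times> int" where
  "wreath_value w = foldl wreath_mult (False, 0) w"

lemma word_value_wreath: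
  "word_value wreath_group (map wreath_elt w) = wreath_elt (wreath_value w)"
proof (induction w rule: rev_induct)
  case Nil
  show ?case by (simp add: word_value_def wreath_value_def wreath_elt_one)
next
  case (snoc y w)
  have "map wreath_elt w \<in> lists (carrier wreath_group)" "wreath_elt y \<in> carrier wreath_group"
    by (auto simp: carrier_wreath_group)
  then show ?case
    using snoc by (simp add: W.word_value_snoc wreath_value_def wreath_elt_mult)
qed

section \<open>Minimal length in a conjugacy class\<close>

definition conj_length :: "bool \<times> int \<times> int \<Rightarrow> nat" where
  "conj_length g = (case g of (j, p, q) \<Rightarrow>
    if j then nat (\<bar>p + q\<bar> + 1)
    else nat (min (\<bar>p + q\<bar> + min \<bar>p\<bar> \<bar>q\<bar>) (\<bar>p\<bar> + \<bar>q\<bar> + 2)))"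

text \<open>Conjugation preserves the parity of \<open>t\<close>. On even elements it can only exchange \<open>p\<close> and \<open>q\<close>; on
  odd elements it preserves \<open>p + q\<close>. The function is invariant under both.\<close>
lemma conj_length_conj:
  assumes "wreath_mult x g = wreath_mult h x"
  shows "conj_length h = conj_length g"
proof -
  obtain i a b where x: "x = (i, a, b)" by (metis prod.exhaust)
  obtain j p q where g: "g = (j, p, q)" by (metis prod.exhaust)
  obtain k r s where h: "h = (k, r, s)" by (metis prod.exhaust)
  show ?thesis
    using assms unfolding x g h
    by (cases i; cases j; cases k) (auto simp: wreath_mult_def twist_def conj_length_def add_ac min.commute)
qed

definition power_word :: "int \<Rightarrow> int \<times> int \<Rightarrow> (bool \<times> int \<times> int) list" where
  "power_word k v = replicate (nat \<bar>k\<bar>) (False, sgn k * fst v, sgn k * snd v)"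

lemma length_power_word: "length (power_word k v) = nat \<bar>k\<bar>"
  by (simp add: power_word_def)

lemma power_word_in_lists:
  assumes "v \<in> {(1, 0), (- 1, 1)}"
  shows "power_word k v \<in> lists wreath_gens"
  using assms by (auto simp: power_word_def wreath_gens_def sgn_if)

lemma foldl_power_word:
  "foldl wreath_mult (j, p) (power_word k v) = (j, p + twist j (k * fst v, k * snd v))"
proof -
  have "foldl wreath_mult (j, p) (replicate n (False, u)) =
      (j, p + twist j (int n * fst u, int n * snd u))" for n u
    by (induction n arbitrary: p)
      (auto simp: wreath_mult_def twist_def prod_eq_iff distrib_right)
  from this[of "nat \<bar>k\<bar>" "(sgn k * fst v, sgn k * snd v)"] show ?thesis
    by (simp add: power_word_def abs_mult_sgn mult.assoc[symmetric])
qed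

lemma ex_wreath_word:
  "\<exists>w\<in>lists wreath_gens. wreath_value w = (False, p, q) \<and> length w = nat (\<bar>p + q\<bar> + \<bar>q\<bar>)"
proof -
  let ?w = "power_word (p + q) (1, 0) @ power_word q (- 1, 1)"
  have "?w \<in> lists wreath_gens"
    using power_word_in_lists by (simp del: in_lists_conv_set)
  moreover have "wreath_value ?w = (False, p, q)"
    by (simp add: wreath_value_def foldl_power_word twist_def zero_prod_def)
  moreover have "length ?w = nat (\<bar>p + q\<bar> + \<bar>q\<bar>)"
    by (simp add: length_power_word nat_add_distrib)
  ultimately show ?thesis by blast
qed

lemma wreath_gens_generate: "\<exists>w\<in>lists wreath_gens. wreath_value w = g"
proof -
  obtain j p q where g: "g = (j, p, q)" by (metis prod.exhaust)
  obtain w where w: "w \<in> lists wreath_gens" "wreath_value w = (False, p, q)"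
    using ex_wreath_word by blast
  have "w @ [(True, 0)] \<in> lists wreath_gens" "wreath_value (w @ [(True, 0)]) = (True, p, q)"
    using w by (auto simp: wreath_gens_def wreath_value_def wreath_mult_def twist_simps)
  then show ?thesis
    using w g by (cases j) (metis (full_types))+
qed

text \<open>For an odd element, conjugation by \<open>(q, 0)\<close> moves the whole vector to the first coordinate. For
  an even element, there is one word for each of the three terms of the minimum.\<close>
lemma conj_length_attained:
  "\<exists>x. \<exists>w\<in>lists wreath_gens.
    wreath_mult x g = wreath_mult (wreath_value w) x \<and> length w = conj_length g"
proof -
  obtain j p q where g: "g = (j, p, q)" by (metis prod.exhaust)
  have t: "(True, 0) \<in> wreath_gens" by (simp add: wreath_gens_def)
  have a: "power_word k (1, 0) \<in> lists wreath_gens" for k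
    by (rule power_word_in_lists) simp
  show ?thesis
  proof (cases j)
    case True
    let ?w = "power_word (p + q) (1, 0) @ [(True, 0)]"
    have "wreath_value ?w = (True, p + q, 0)"
      by (simp add: wreath_value_def foldl_power_word wreath_mult_def twist_def prod_eq_iff)
    then have "wreath_mult (False, q, 0) g = wreath_mult (wreath_value ?w) (False, q, 0)"
      using True g by (simp add: wreath_mult_def twist_def)
    moreover have "?w \<in> lists wreath_gens"
      using a t by (simp del: in_lists_conv_set)
    moreover have "length ?w = conj_length g"
      using True g by (simp add: length_power_word conj_length_def)
    ultimately show ?thesis by blast
  next
    case False
    define n where "n = int (conj_length g)"
    have n: "n = min (\<bar>p + q\<bar> + min \<bar>p\<bar> \<bar>q\<bar>) (\<bar>p\<bar> + \<bar>q\<bar> + 2)"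
      using False g by (simp add: n_def conj_length_def)
    consider "n = \<bar>p + q\<bar> + \<bar>q\<bar>" | "n = \<bar>q + p\<bar> + \<bar>p\<bar>" | "n = \<bar>p\<bar> + \<bar>q\<bar> + 2"
      using n by linarith
    then show ?thesis
    proof cases
      case 1
      obtain w where "w \<in> lists wreath_gens" "wreath_value w = g" "length w = conj_length g"
        using ex_wreath_word[of p q] 1 False g n_def by (metis nat_int)
      then show ?thesis
        using False g
        by (intro exI[of _ "(False, 0)"] bexI[of _ w]) (simp_all add: wreath_mult_def twist_def)
    next
      case 2
      obtain w where "w \<in> lists wreath_gens" "wreath_value w = (False, q, p)"
        "length w = conj_length g"
        using ex_wreath_word[of q p] 2 n_def by (metis nat_int)
      then show ?thesis
        using False g
        by (intro exI[of _ "(True, 0)"] bexI[of _ w]) (simp_all add: wreath_mult_def twist_def zero_prod_def)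
    next
      case 3
      let ?w = "power_word p (1, 0) @ [(True, 0)] @ power_word q (1, 0) @ [(True, 0)]"
      have "wreath_value ?w = g"
        using False g
        by (simp add: wreath_value_def foldl_power_word wreath_mult_def twist_def zero_prod_def)
      then have "wreath_mult (False, 0) g = wreath_mult (wreath_value ?w) (False, 0)"
        using False g by (simp add: wreath_mult_def twist_def)
      moreover have "?w \<in> lists wreath_gens"
        using a t by (simp del: in_lists_conv_set)
      moreover have "length ?w = conj_length g"
        using 3 by (simp add: length_power_word n_def)
      ultimately show ?thesis by blast
    qed
  qed
qed

section \<open>Regularity\<close>

text \<open>The entries of a profile \<open>(n, a, a', c, c', b, b')\<close> are the number of letters \<open>t\<close> and the
  numbers of steps \<open>(1, 0)\<close>, \<open>(-1, 0)\<close>, \<open>(0, 1)\<close>, \<open>(0, -1)\<close>, \<open>(-1, 1)\<close>, \<open>(1, -1)\<close> of the walk that a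
  word describes. A letter after an odd number of \<open>t\<close> is counted as its mirror image, so \<open>c\<close> and \<open>c'\<close>
  count the occurrences of \<open>a\<close> and its inverse after an odd number of \<open>t\<close>.\<close>
type_synonym profile = "nat \<times> nat \<times> nat \<times> nat \<times> nat \<times> nat \<times> nat"

definition profile_step :: "profile \<Rightarrow> bool \<times> int \<times> int \<Rightarrow> profile" where
  "profile_step s y = (case s of (n, a, a', c, c', b, b') \<Rightarrow>
    if fst y then (Suc n, a, a', c, c', b, b')
    else let u = twist (odd n) (snd y) in
      (n, a + of_bool (u = (1, 0)), a' + of_bool (u = (- 1, 0)),
        c + of_bool (u = (0, 1)), c' + of_bool (u = (0, - 1)),
        b + of_bool (u = (- 1, 1)), b' + of_bool (u = (1, - 1))))"

definition profile :: "(bool \<times> int \<times> int) list \<Rightarrow> profile" where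
  "profile w = foldl profile_step (0, 0, 0, 0, 0, 0, 0) w"

lemma profile_step_simps:
  "profile_step (n, a, a', c, c', b, b') (True, v) = (Suc n, a, a', c, c', b, b')"
  "profile_step (n, a, a', c, c', b, b') (False, 1, 0) =
    (if odd n then (n, a, a', Suc c, c', b, b') else (n, Suc a, a', c, c', b, b'))"
  "profile_step (n, a, a', c, c', b, b') (False, - 1, 0) =
    (if odd n then (n, a, a', c, Suc c', b, b') else (n, a, Suc a', c, c', b, b'))"
  "profile_step (n, a, a', c, c', b, b') (False, - 1, 1) =
    (if odd n then (n, a, a', c, c', b, Suc b') else (n, a, a', c, c', Suc b, b'))"
  "profile_step (n, a, a', c, c', b, b') (False, 1, - 1) =
    (if odd n then (n, a, a', c, c', Suc b, b') else (n, a, a', c, c', b, Suc b'))"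
  by (simp_all add: profile_step_def twist_def)

text \<open>The last conjunct holds because steps along the second axis need a preceding \<open>t\<close>.\<close>
lemma profile_invariant:
  assumes "w \<in> lists wreath_gens"
  shows "case profile w of (n, a, a', c, c', b, b') \<Rightarrow>
    wreath_value w = (odd n, int a - int a' - int b + int b', int c - int c' + int b - int b') \<and>
    length w = n + a + a' + c + c' + b + b' \<and> (n = 0 \<longrightarrow> c = 0 \<and> c' = 0)"
  using assms
proof (induction w rule: rev_induct)
  case Nil
  then show ?case by (simp add: wreath_value_def profile_def zero_prod_def)
next
  case (snoc y w)
  obtain n a a' c c' b b' where w: "profile w = (n, a, a', c, c', b, b')"
    by (metis prod.exhaust)
  have IH: "wreath_value w = (odd n, int a - int a' - int b + int b', int c - int c' + int b - int b')"
    "length w = n + a + a' + c + c' + b + b'" "n = 0 \<longrightarrow> c = 0 \<and> c' = 0"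
    using snoc w by simp_all
  have step: "wreath_value (w @ [y]) = wreath_mult (wreath_value w) y"
    "profile (w @ [y]) = profile_step (profile w) y"
    by (simp_all add: wreath_value_def profile_def)
  have "y \<in> {(False, 1, 0), (False, - 1, 0), (False, - 1, 1), (False, 1, - 1), (True, 0, 0)}"
    using snoc.prems by (simp add: wreath_gens_def zero_prod_def)
  then show ?case
    unfolding step w IH(1) using IH(2,3)
    by (elim insertE emptyE) (auto simp: profile_step_simps wreath_mult_def twist_def zero_prod_def elim: oddE)
qed

text \<open>With one \<open>t\<close> only \<open>p + q\<close> matters. The diagonal steps do not change it, and among the others
  every step must go in the same direction.\<close>
lemma one_turn_arith:
  fixes a a' c c' b b' :: int
  assumes "0 \<le> a" "0 \<le> a'" "0 \<le> c" "0 \<le> c'" "0 \<le> b" "0 \<le> b'"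
    and "p = a - a' - b + b'" "q = c - c' + b - b'"
  shows "\<bar>p + q\<bar> \<le> a + a' + c + c' + b + b'"
    and "a + a' + c + c' + b + b' = \<bar>p + q\<bar> \<longleftrightarrow>
      b = 0 \<and> b' = 0 \<and> (a' = 0 \<and> c' = 0 \<or> a = 0 \<and> c = 0)"
  using assms by (smt (verit))+

text \<open>With two \<open>t\<close> the word must realise the third term of the minimum, \<open>|p| + |q| + 2\<close>, with \<open>p\<close> and \<open>q\<close>
  of the same sign. This term is minimal when both \<open>|p|\<close> and \<open>|q|\<close> are at least two: otherwise one of
  the words without \<open>t\<close> is shorter.\<close>
lemma two_turns_arith:
  fixes a a' c c' b b' :: int
  assumes "0 \<le> a" "0 \<le> a'" "0 \<le> c" "0 \<le> c'" "0 \<le> b" "0 \<le> b'"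
    and "p = a - a' - b + b'" "q = c - c' + b - b'"
  shows "min (\<bar>p + q\<bar> + min \<bar>p\<bar> \<bar>q\<bar>) (\<bar>p\<bar> + \<bar>q\<bar> + 2) \<le> 2 + a + a' + c + c' + b + b'"
    and "2 + a + a' + c + c' + b + b' = min (\<bar>p + q\<bar> + min \<bar>p\<bar> \<bar>q\<bar>) (\<bar>p\<bar> + \<bar>q\<bar> + 2) \<longleftrightarrow>
      b = 0 \<and> b' = 0 \<and>
        (a' = 0 \<and> c' = 0 \<and> 2 \<le> a \<and> 2 \<le> c \<or> a = 0 \<and> c = 0 \<and> 2 \<le> a' \<and> 2 \<le> c')"
  using assms by (smt (verit))+

text \<open>Without \<open>t\<close> the word must be geodesic in \<open>A\<close>, so it uses only one sign of each generator. If the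
  signs of \<open>a\<close> and \<open>b\<close> are opposite, nothing shorter is conjugate to it. If they agree, say both are
  positive, the vector is \<open>(a - b, b)\<close>. Then exchanging the coordinates must not help, which bounds
  \<open>b\<close> by \<open>a - b\<close> unless \<open>a = 0\<close>, and the detour through \<open>t\<close> must not help, which bounds \<open>b\<close> by two.\<close>
lemma no_turn_arith:
  fixes a a' b b' :: int
  assumes "0 \<le> a" "0 \<le> a'" "0 \<le> b" "0 \<le> b'"
    and "p = a - a' - b + b'" "q = b - b'"
  shows "min (\<bar>p + q\<bar> + min \<bar>p\<bar> \<bar>q\<bar>) (\<bar>p\<bar> + \<bar>q\<bar> + 2) \<le> a + a' + b + b'"
    and "a + a' + b + b' = min (\<bar>p + q\<bar> + min \<bar>p\<bar> \<bar>q\<bar>) (\<bar>p\<bar> + \<bar>q\<bar> + 2) \<longleftrightarrow>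
      a' = 0 \<and> b = 0 \<or> a = 0 \<and> b' = 0 \<or>
      a' = 0 \<and> b' = 0 \<and> (a = 0 \<or> b = 1 \<and> 2 \<le> a \<or> b = 2 \<and> 4 \<le> a) \<or>
      a = 0 \<and> b = 0 \<and> (a' = 0 \<or> b' = 1 \<and> 2 \<le> a' \<or> b' = 2 \<and> 4 \<le> a')"
  using assms by (smt (verit))+

definition geodesic_profile :: "profile \<Rightarrow> bool" where
  "geodesic_profile s = (case s of (n, a, a', c, c', b, b') \<Rightarrow>
    (n = 0 \<and>
      (a' = 0 \<and> b = 0 \<or> a = 0 \<and> b' = 0 \<or>
       a' = 0 \<and> b' = 0 \<and> (a = 0 \<or> b = 1 \<and> 2 \<le> a \<or> b = 2 \<and> 4 \<le> a) \<or>
       a = 0 \<and> b = 0 \<and> (a' = 0 \<or> b' = 1 \<and> 2 \<le> a' \<or> b' = 2 \<and> 4 \<le> a'))) \<or>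
    (n = 1 \<and> b = 0 \<and> b' = 0 \<and> (a' = 0 \<and> c' = 0 \<or> a = 0 \<and> c = 0)) \<or>
    (n = 2 \<and> b = 0 \<and> b' = 0 \<and>
      (a' = 0 \<and> c' = 0 \<and> 2 \<le> a \<and> 2 \<le> c \<or> a = 0 \<and> c = 0 \<and> 2 \<le> a' \<and> 2 \<le> c')))"

text \<open>Three or more letters \<open>t\<close> are always wasteful: the letters other than \<open>t\<close> already account for the
  minimum up to one \<open>t\<close> in odd and two in even parity.\<close>
lemma
  assumes w: "w \<in> lists wreath_gens"
  shows conj_length_le: "conj_length (wreath_value w) \<le> length w"
    and conj_length_eq_iff: "length w = conj_length (wreath_value w) \<longleftrightarrow> geodesic_profile (profile w)"
proof -
  obtain n a a' c c' b b' where prof: "profile w = (n, a, a', c, c', b, b')"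
    by (metis prod.exhaust)
  define p where "p = int a - int a' - int b + int b'"
  define q where "q = int c - int c' + int b - int b'"
  have val: "wreath_value w = (odd n, p, q)"
    and len: "int (length w) = int n + int a + int a' + int c + int c' + int b + int b'"
    and no_turn: "n = 0 \<Longrightarrow> c = 0 \<and> c' = 0"
    using profile_invariant[OF w] by (simp_all add: prof p_def q_def)
  define m where "m = int (conj_length (wreath_value w))"
  define l where "l = int (length w)"
  have odd: "m = 1 + \<bar>p + q\<bar>" if "odd n"
    using that by (simp add: m_def val conj_length_def)
  have even: "m = min (\<bar>p + q\<bar> + min \<bar>p\<bar> \<bar>q\<bar>) (\<bar>p\<bar> + \<bar>q\<bar> + 2)" if "\<not> odd n"
    using that by (simp add: m_def val conj_length_def)
  note nonneg = of_nat_0_le_iff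
  note one_turn = one_turn_arith[OF nonneg nonneg nonneg nonneg nonneg nonneg p_def q_def]
  note two_turns = two_turns_arith[OF nonneg nonneg nonneg nonneg nonneg nonneg p_def q_def]
  have nat: "int k = 0 \<longleftrightarrow> k = 0" "int k = 1 \<longleftrightarrow> k = 1" "int k = 2 \<longleftrightarrow> k = 2"
    "2 \<le> int k \<longleftrightarrow> 2 \<le> k" "4 \<le> int k \<longleftrightarrow> 4 \<le> k" for k
    by auto
  consider "n = 0" | "n = 1" | "n = 2" | "3 \<le> n"
    by linarith
  then have "m \<le> l \<and> (l = m \<longleftrightarrow> geodesic_profile (profile w))"
  proof cases
    case 1
    have q: "q = int b - int b'" and l: "l = int a + int a' + int b + int b'"
      using 1 no_turn len by (simp_all add: q_def l_def)
    have m: "m = min (\<bar>p + q\<bar> + min \<bar>p\<bar> \<bar>q\<bar>) (\<bar>p\<bar> + \<bar>q\<bar> + 2)"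
      by (rule even) (simp add: 1)
    note arith = no_turn_arith[OF nonneg nonneg nonneg nonneg p_def q, folded m l]
    show ?thesis
      using arith(1) arith(2)[unfolded nat] 1 by (simp add: prof geodesic_profile_def)
  next
    case 2
    have m: "m = 1 + \<bar>p + q\<bar>"
      by (rule odd) (simp add: 2)
    have l: "l = 1 + (int a + int a' + int c + int c' + int b + int b')"
      using 2 len by (simp add: l_def)
    have "m \<le> l" "l = m \<longleftrightarrow> b = 0 \<and> b' = 0 \<and> (a' = 0 \<and> c' = 0 \<or> a = 0 \<and> c = 0)"
      unfolding m l add_le_cancel_left add_left_cancel by (rule one_turn(1) one_turn(2)[unfolded nat])+
    then show ?thesis
      using 2 by (simp add: prof geodesic_profile_def)
  next
    case 3
    have m: "m = min (\<bar>p + q\<bar> + min \<bar>p\<bar> \<bar>q\<bar>) (\<bar>p\<bar> + \<bar>q\<bar> + 2)"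
      by (rule even) (simp add: 3)
    have l: "l = 2 + int a + int a' + int c + int c' + int b + int b'"
      using 3 len by (simp add: l_def)
    note arith = two_turns[folded m l]
    show ?thesis
      using arith(1) arith(2)[unfolded nat] 3 by (simp add: prof geodesic_profile_def)
  next
    case 4
    have "m < l"
    proof (cases "odd n")
      case True
      then show ?thesis
        using one_turn(1) len 4 unfolding odd[OF True] l_def by linarith
    next
      case False
      then have "4 \<le> n"
        using 4 by presburger
      then show ?thesis
        using two_turns(1)[folded even[OF False]] len unfolding l_def by linarith
    qed
    then show ?thesis
      using 4 by (simp add: prof geodesic_profile_def)
  qed
  then show "conj_length (wreath_value w) \<le> length w"
    "length w = conj_length (wreath_value w) \<longleftrightarrow> geodesic_profile (profile w)"
    by (simp_all add: m_def l_def)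
qed

text \<open>Four is the largest constant that the geodesic condition compares a count with. All profiles with
  at least three \<open>t\<close> are merged into one rejecting state; this is also what keeps the parity of \<open>n\<close>,
  on which the next step depends, exact as long as it matters.\<close>
definition cap_profile :: "profile \<Rightarrow> profile" where
  "cap_profile s = (case s of (n, a, a', c, c', b, b') \<Rightarrow>
    if 3 \<le> n then (3, 0, 0, 0, 0, 0, 0)
    else (n, min 4 a, min 4 a', min 4 c, min 4 c', min 4 b, min 4 b'))"

lemma cap_profile_step: "cap_profile (profile_step (cap_profile s) y) = cap_profile (profile_step s y)"
proof -
  have m: "min 4 (min 4 k + of_bool P) = min (4 :: nat) (k + of_bool P)" for k P
    by auto
  show ?thesis
    by (cases s) (auto simp: cap_profile_def profile_step_def Let_def m)
qed

lemma geodesic_profile_cap: "geodesic_profile (cap_profile s) \<longleftrightarrow> geodesic_profile s"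
proof -
  have eq: "min 4 k = 0 \<longleftrightarrow> k = 0" "min 4 k = 1 \<longleftrightarrow> k = 1" "min 4 k = 2 \<longleftrightarrow> k = 2" for k :: nat
    by auto
  show ?thesis
    by (cases s) (simp only: cap_profile_def geodesic_profile_def case_prod_conv eq min.bounded_iff
        split: if_split, simp)
qed

lemma finite_range_cap_profile: "finite (range cap_profile)"
proof (rule finite_subset)
  show "range cap_profile \<subseteq> {..4} \<times> {..4} \<times> {..4} \<times> {..4} \<times> {..4} \<times> {..4} \<times> {..4}"
    by (auto simp: cap_profile_def split: if_splits)
  show "finite ({..4} \<times> {..4} \<times> {..4} \<times> {..4} \<times> {..4} \<times> {..4} \<times> {..(4 :: nat)} :: profile set)"
    by simp
qed

lemma regular_wreath_ConjGeo:
  "regular_language wreath_gens {w \<in> lists wreath_gens. length w = conj_length (wreath_value w)}"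
proof (rule regular_languageI[where f = "\<lambda>w. cap_profile (profile w)"
      and \<delta> = "\<lambda>s y. cap_profile (profile_step s y)" and P = geodesic_profile])
  show "finite wreath_gens" by (simp add: wreath_gens_def)
  show "finite ((\<lambda>w. cap_profile (profile w)) ` lists wreath_gens)"
    by (rule finite_subset[OF _ finite_range_cap_profile]) blast
  show "cap_profile (profile (w @ [y])) = cap_profile (profile_step (cap_profile (profile w)) y)" for w y
    by (simp add: profile_def cap_profile_step)
  show "w \<in> {w \<in> lists wreath_gens. length w = conj_length (wreath_value w)} \<longleftrightarrow>
      geodesic_profile (cap_profile (profile w))" if "w \<in> lists wreath_gens" for w
    using conj_length_eq_iff[OF that] that by (simp add: geodesic_profile_cap)
qed blast

lemma ConjGeo_wreath:
  "ConjGeo wreath_group (wreath_elt ` wreath_gens) =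
    map wreath_elt ` {w \<in> lists wreath_gens. length w = conj_length (wreath_value w)}"
proof -
  let ?N = "\<lambda>g. conj_length (inv_into UNIV wreath_elt g)"
  have N: "?N (word_value wreath_group (map wreath_elt w)) = conj_length (wreath_value w)" for w
    by (simp add: word_value_wreath inj_wreath_elt)
  have L: "lists (wreath_elt ` wreath_gens) = map wreath_elt ` lists wreath_gens"
    by (rule lists_image)
  have "ConjGeo wreath_group (wreath_elt ` wreath_gens) =
      {w \<in> lists (wreath_elt ` wreath_gens). length w = ?N (word_value wreath_group w)}"
  proof (rule W.ConjGeo_eqI)
    show "word_value wreath_group ` lists (wreath_elt ` wreath_gens) = carrier wreath_group"
    proof -
      have "wreath_value ` lists wreath_gens = UNIV"
        using wreath_gens_generate by (metis UNIV_eq_I image_eqI)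
      then show ?thesis
        unfolding L image_image word_value_wreath carrier_wreath_group
        by (metis image_image)
    qed
  next
    fix w
    assume "w \<in> lists (wreath_elt ` wreath_gens)"
    then obtain v where "v \<in> lists wreath_gens" "w = map wreath_elt v"
      unfolding L by blast
    then show "?N (word_value wreath_group w) \<le> length w"
      using conj_length_le by (simp add: N del: in_lists_conv_set)
  next
    fix x g h
    assume "x \<in> carrier wreath_group" "g \<in> carrier wreath_group" "h \<in> carrier wreath_group"
      and eq: "x \<otimes>\<^bsub>wreath_group\<^esub> g = h \<otimes>\<^bsub>wreath_group\<^esub> x"
    then obtain x' g' h' where e: "x = wreath_elt x'" "g = wreath_elt g'" "h = wreath_elt h'"
      unfolding carrier_wreath_group by blast
    then have "wreath_mult x' g' = wreath_mult h' x'"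
      using eq inj_wreath_elt by (simp add: inj_eq flip: wreath_elt_mult)
    then show "?N h = ?N g"
      using conj_length_conj[of x' g' h'] e by (simp add: inj_wreath_elt)
  next
    fix g
    assume "g \<in> carrier wreath_group"
    then obtain g' where g: "g = wreath_elt g'"
      unfolding carrier_wreath_group by blast
    obtain x w where w: "w \<in> lists wreath_gens"
      and eq: "wreath_mult x g' = wreath_mult (wreath_value w) x" and len: "length w = conj_length g'"
      using conj_length_attained by blast
    show "\<exists>x\<in>carrier wreath_group. \<exists>w\<in>lists (wreath_elt ` wreath_gens).
        x \<otimes>\<^bsub>wreath_group\<^esub> g = word_value wreath_group w \<otimes>\<^bsub>wreath_group\<^esub> x \<and> length w = ?N g"
    proof (intro bexI conjI)
      show "wreath_elt x \<otimes>\<^bsub>wreath_group\<^esub> g =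
          word_value wreath_group (map wreath_elt w) \<otimes>\<^bsub>wreath_group\<^esub> wreath_elt x"
        by (simp add: g word_value_wreath eq flip: wreath_elt_mult)
      show "length (map wreath_elt w) = ?N g"
        using len g by (simp add: inj_wreath_elt)
      show "map wreath_elt w \<in> lists (wreath_elt ` wreath_gens)"
        unfolding L using w by blast
      show "wreath_elt x \<in> carrier wreath_group"
        unfolding carrier_wreath_group by blast
    qed
  qed
  also have "\<dots> = map wreath_elt ` {w \<in> lists wreath_gens. length w = conj_length (wreath_value w)}"
    unfolding L using N by auto
  finally show ?thesis .
qed

theorem corollary5p12:
  shows "\<exists>(\<Gamma> :: nat pair_pre_digraph) \<phi> (m :: nat).
    pair_graph \<Gamma> \<and>
    \<phi> \<in> auto (raag \<Gamma>) \<and>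
    0 < m \<and> \<phi> [^]\<^bsub>AutoGroup (raag \<Gamma>)\<^esub> m = \<one>\<^bsub>AutoGroup (raag \<Gamma>)\<^esub> \<and>
    \<not> length_preserving (raag \<Gamma>) (raag_gens \<Gamma>) \<phi> \<and>
    regular_language (virtual_raag_gens \<Gamma> \<phi> m)
      (ConjGeo (virtual_raag \<Gamma> \<phi> m) (virtual_raag_gens \<Gamma> \<phi> m))"
proof (intro exI conjI)
  show "pair_graph edge_graph" by (rule pair_graph_edge_graph)
  show "edge_swap \<in> auto (raag edge_graph)" by (rule edge_swap_auto)
  show "0 < (2 :: nat)" by simp
  show "edge_swap [^]\<^bsub>AutoGroup (raag edge_graph)\<^esub> (2 :: nat) =
      \<one>\<^bsub>AutoGroup (raag edge_graph)\<^esub>"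
    by (rule edge_swap_order)
  show "\<not> length_preserving (raag edge_graph) (raag_gens edge_graph) edge_swap"
    by (rule edge_swap_not_length_preserving)
  show "regular_language (virtual_raag_gens edge_graph edge_swap 2)
      (ConjGeo wreath_group (virtual_raag_gens edge_graph edge_swap 2))"
    unfolding virtual_raag_gens_eq ConjGeo_wreath
    by (rule regular_language_image[OF regular_wreath_ConjGeo
          inj_on_subset[OF inj_wreath_elt subset_UNIV]])
qed

end
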